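(* Let $q\ge 3$ be an integer. The number $|\mathscr{G}|$ of cyclic subgroups of $(\mathbb{Z}/q\mathbb{Z})^\times$ is given by $$|\mathscr{G}|=\prod_{\substack{p|\varphi(q),\\ p\neq2}}\frac{p-2}{p-1}\ \sum_{\substack{d|\varphi(q),\\ 2|d}}\frac{\rho(q;d)}{\varphi(d)}\prod_{\substack{p|d,\\ p|\varphi(q)/d,\\ p\neq2}}\frac{(p-1)^2}{p(p-2)}\prod_{\substack{p|d,\\ p\nmid\varphi(q)/d,\\ p\neq2}}\frac{p-1}{p-2}\prod_{\substack{2|d,\\ 2|\varphi(q)/d}}\frac12,$$ where $p$ denotes primes and the last product equals $\frac12$ if $2|d$ and $2|\varphi(q)/d$, and $1$ otherwise.
   Context: $\varphi$ is Euler's totient function. $\rho(q;d)$ is the number of solutions $x\in\mathbb{Z}/q\mathbb{Z}$ of $x^d\equiv 1 \bmod q$. It is multiplicative in $q$, and for a prime $p$ and $\alpha\ge1$: $\rho(p^\alpha;d)=\gcd(d,p^{\alpha-1}(p-1))$ if $p\ne2$; $\rho(2;d)=1$; for $\alpha\ge2$, $\rho(2^\alpha;d)=1$ if $d$ is odd and $\rho(2^\alpha;d)=2\gcd(d,2^{\alpha-2})$ if $d$ is even. *)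

theory Defs
  imports "HOL-Number_Theory.Number_Theory" "HOL-Algebra.Elementary_Groups"
begin

(* Residue classes modulo q (for q > 0) are represented by their least
   nonnegative representatives. *)
definition rho :: "nat \<Rightarrow> nat \<Rightarrow> nat" where
  "rho q d = card {x \<in> {0..<q}. [x ^ d = 1] (mod q)}"

definition cyclic_subgroups :: "('a, 'b) monoid_scheme \<Rightarrow> 'a set set" where
  "cyclic_subgroups G = {H. subgroup H G \<and> cyclic_group (G\<lparr>carrier := H\<rparr>)}"

definition mult_residue_group :: "nat \<Rightarrow> int monoid" where
  "mult_residue_group q = units_of (residue_ring (int q))"

end

theory Submission
  imports Defs
begin

text \<open>
  A cyclic subgroup of order \<open>e\<close> has \<open>\<phi>(e)\<close> generators, so the number of cyclic subgroups of a
  group of order \<open>n\<close> is the sum of \<open>1/\<phi>(ord x)\<close> over its elements \<open>x\<close>. With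
  \<open>w(d,r) = 1/\<phi>(d) \<cdot> \<Prod>\<^bsub>p|r\<^esub> (1 - \<phi>(d)/\<phi>(pd))\<close> one has
  \<open>1/\<phi>(e) = \<Sum>\<^bsub>e|d|n\<^esub> w(d, n/d)\<close>; exchanging sums turns the count into the sum over \<open>d|n\<close> of
  \<open>w(d, n/d)\<close> times the number of solutions of \<open>x\<^sup>d = 1\<close>. For even \<open>n\<close> and odd \<open>d\<close> the factor
  at \<open>p = 2\<close> is \<open>1 - \<phi>(d)/\<phi>(2d) = 0\<close>, so only even \<open>d\<close> contribute.
\<close>

section \<open>The number of cyclic subgroups of a finite group\<close>

context group
begin

text \<open>Equal generated subgroups force equal orders, and \<open>a [^] k\<close> has the order
  of \<open>a\<close> exactly when \<open>k\<close> is coprime to it. Conversely, the subgroup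
  generated by \<open>a [^] k\<close> lies in the finite one generated by \<open>a\<close>, so equal
  orders make the two coincide.\<close>

lemma generators_of_cyclic_subgroup:
  assumes fin: "finite (carrier G)" and a: "a \<in> carrier G"
  shows "{x \<in> carrier G. generate G {x} = generate G {a}} = (\<lambda>k. a [^] k) ` totatives (ord a)"
    (is "?L = ?R")
proof (intro subset_antisym subsetI)
  have oa: "ord a \<ge> 1" using ord_ge_1[OF fin a] .
  fix x assume "x \<in> ?L"
  then have x: "x \<in> carrier G" and gen: "generate G {x} = generate G {a}" by auto
  have "x \<in> generate G {a}" using gen generate.incl[of x "{x}" G] by auto
  then have "x \<in> {a [^] k | k. k \<in> {0 .. ord a - 1}}"
    using generate_pow_on_finite_carrier[OF fin a] ord_elems[OF fin a] by blast
  then obtain j where j: "x = a [^] j" "j \<le> ord a - 1" by auto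
  \<comment> \<open>The exponent 0 is traded for \<open>ord a\<close>, because totatives are
    positive; for \<open>ord a = 1\<close> this gives the exponent 1.\<close>
  obtain k :: nat where k: "x = a [^] k" "0 < k" "k \<le> ord a"
  proof (cases "j = 0")
    case True
    then show ?thesis using that[of "ord a"] j oa a by simp
  next
    case False
    then show ?thesis using that[of j] j by simp
  qed
  have "ord x = ord a" using gen generate_pow_card[OF x] generate_pow_card[OF a] by simp
  then have "coprime k (ord a)" using pow_ord_eq_ord_iff[OF fin a] k by simp
  then show "x \<in> ?R" using k by (auto simp: in_totatives_iff)
next
  fix x assume "x \<in> ?R"
  then obtain k where k: "x = a [^] k" "coprime k (ord a)" by (auto simp: in_totatives_iff)
  have x: "x \<in> carrier G" using k a by simp
  have "ord x = ord a" using pow_ord_eq_ord_iff[OF fin a] k by simp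
  then have card: "card (generate G {x}) = card (generate G {a})"
    using generate_pow_card[OF x] generate_pow_card[OF a] by simp
  have "x \<in> generate G {a}"
    using generate_pow_on_finite_carrier[OF fin a] k by auto
  then have "generate G {x} \<subseteq> generate G {a}"
    using generate_subgroup_incl[of "{x}" "generate G {a}"] generate_is_subgroup[of "{a}"] a by simp
  moreover have "finite (generate G {a})"
    using finite_subset[OF generate_incl[of "{a}"] fin] a by simp
  ultimately show "x \<in> ?L" using card x card_subset_eq by auto
qed

lemma card_generators_of_cyclic_subgroup:
  assumes "finite (carrier G)" and a: "a \<in> carrier G"
  shows "card {x \<in> carrier G. generate G {x} = generate G {a}} = totient (ord a)"
proof -
  have "totatives (ord a) \<subseteq> {1 .. ord a}" by (auto simp: in_totatives_iff)
  then have "inj_on (\<lambda>k. a [^] k) (totatives (ord a))"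
    using ord_inj'[OF a] by (rule inj_on_subset[rotated])
  then show ?thesis
    by (simp add: generators_of_cyclic_subgroup[OF assms] card_image totient_def)
qed

lemma cyclic_subgroups_eq: "cyclic_subgroups G = (\<lambda>x. generate G {x}) ` carrier G"
proof (intro subset_antisym subsetI)
  fix H assume "H \<in> cyclic_subgroups G"
  then have H: "subgroup H G" and "cyclic_group (G\<lparr>carrier := H\<rparr>)"
    by (auto simp: cyclic_subgroups_def)
  then obtain x where x: "x \<in> H" "generate (G\<lparr>carrier := H\<rparr>) {x} = H"
    by (auto simp: cyclic_group_def subgroup_generated_def)
      (metis partial_object.select_convs(1) partial_object.surjective partial_object.update_convs(1))
  then have "generate G {x} = H" using generate_consistent[OF _ H, of "{x}"] by simp
  then show "H \<in> (\<lambda>x. generate G {x}) ` carrier G"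
    using x subgroup.subset[OF H] by auto
next
  fix H assume "H \<in> (\<lambda>x. generate G {x}) ` carrier G"
  then obtain x where x: "x \<in> carrier G" "H = generate G {x}" by auto
  have "subgroup_generated G {x} = G\<lparr>carrier := H\<rparr>"
    using x by (simp add: subgroup_generated_def)
  then show "H \<in> cyclic_subgroups G"
    using x generate_is_subgroup[of "{x}"] cyclic_group_generated[of x]
    by (auto simp: cyclic_subgroups_def)
qed

lemma card_cyclic_subgroups:
  assumes fin: "finite (carrier G)"
  shows "real (card (cyclic_subgroups G)) = (\<Sum>x\<in>carrier G. 1 / real (totient (ord x)))"
proof -
  \<comment> \<open>The elements are grouped by the subgroup they generate. The group of
    \<open>H\<close> consists of the generators of \<open>H\<close>, all of the same order, and so
    contributes exactly 1.\<close>
  have "(\<Sum>x\<in>{x \<in> carrier G. generate G {x} = H}. 1 / real (totient (ord x))) = 1"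
    if "H \<in> cyclic_subgroups G" for H
  proof -
    from that obtain a where a: "a \<in> carrier G" "H = generate G {a}"
      by (auto simp: cyclic_subgroups_eq)
    have "(\<Sum>x\<in>{x \<in> carrier G. generate G {x} = H}. 1 / real (totient (ord x)))
        = (\<Sum>x\<in>{x \<in> carrier G. generate G {x} = H}. 1 / real (totient (ord a)))"
      using a by (intro sum.cong) (auto simp: generate_pow_card)
    also have "\<dots> = 1"
      using card_generators_of_cyclic_subgroup[OF fin a(1)] ord_ge_1[OF fin a(1)] a
      by simp
    finally show ?thesis .
  qed
  then have "real (card (cyclic_subgroups G)) =
      (\<Sum>H\<in>cyclic_subgroups G. \<Sum>x\<in>{x \<in> carrier G. generate G {x} = H}. 1 / real (totient (ord x)))"
    by simp
  also have "\<dots> = (\<Sum>x\<in>carrier G. 1 / real (totient (ord x)))"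
    unfolding cyclic_subgroups_eq by (rule sum.image_gen[OF fin, symmetric])
  finally show ?thesis .
qed

end

section \<open>Inverting the totient function along divisor sums\<close>

lemma totient_mult_prime:
  fixes p n :: nat
  assumes p: "prime p"
  shows "totient (p * n) = (if p dvd n then p else p - 1) * totient n"
proof (cases "p dvd n")
  case True
  have "totient (p * n) = (p - 1) * totient n * p div (p - 1)"
    using totient_mult[of p n] True p by (simp add: totient_prime gcd_nat.absorb1)
  also have "\<dots> = p * totient n"
    using prime_gt_1_nat[OF p] by (simp add: mult.assoc mult.commute)
  finally show ?thesis using True by simp
next
  case False
  then have "coprime p n" using p by (rule prime_imp_coprime[rotated])
  then show ?thesis using False p by (simp add: totient_mult_coprime totient_prime)
qed

text \<open>For positive arguments this is the sum of \<open>mu s / totient (s * d)\<close> over the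
  divisors \<open>s\<close> of \<open>r\<close>, with \<open>mu\<close> the Moebius function,
  written as an Euler product: the inversion of \<open>1 / totient\<close> over multiples. Keeping
  \<open>r\<close> separate from \<open>d\<close> allows adding one prime at a time to
  \<open>r\<close>.\<close>

definition totient_weight :: "nat \<Rightarrow> nat \<Rightarrow> real" where
  "totient_weight d r =
    (\<Prod>p\<in>prime_factors r. 1 - real (totient d) / real (totient (p * d))) / real (totient d)"

lemma totient_weight_mult_prime_dvd:
  assumes "prime p" "p dvd r" "r > 0"
  shows "totient_weight d (p * r) = totient_weight d r"
proof -
  have "prime_factors (p * r) = prime_factors r"
    using assms by (auto simp: prime_factors_product prime_prime_factors in_prime_factors_iff)
  then show ?thesis by (simp add: totient_weight_def)
qed

text \<open>The new Euler factor at \<open>p\<close> takes the fraction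
  \<open>totient d / totient (p * d)\<close> away from the weight of \<open>d\<close>, and
  \<open>totient_weight (p * d) r\<close> is exactly that fraction.\<close>

lemma totient_weight_mult_prime_not_dvd:
  assumes p: "prime p" and ndvd: "\<not> p dvd r" and "r > 0" "d > 0"
  shows "totient_weight d (p * r) + totient_weight (p * d) r = totient_weight d r"
proof -
  define A where "A = (\<Prod>s\<in>prime_factors r. 1 - real (totient d) / real (totient (s * d)))"
  have "totient_weight d (p * r) = (1 - totient d / totient (p * d)) * A / totient d"
    using assms by (simp add: totient_weight_def A_def prime_factors_product
        prime_prime_factors in_prime_factors_iff)
  moreover have "totient_weight (p * d) r = A / totient (p * d)"
  proof -
    \<comment> \<open>The ratio depends only on \<open>s\<close> and on whether \<open>s\<close>
      divides \<open>d\<close>; multiplying \<open>d\<close> by a prime \<open>p\<close> other than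
      \<open>s\<close> does not affect this.\<close>
    have "real (totient (p * d)) / totient (s * (p * d)) = real (totient d) / totient (s * d)"
      if "s \<in> prime_factors r" for s
    proof -
      from that have s: "prime s" "s dvd r" by (auto simp: in_prime_factors_iff)
      then have "\<not> s dvd p" using p ndvd primes_dvd_imp_eq by blast
      then show ?thesis
        using p s prime_gt_1_nat[OF p]
        by (auto simp: totient_mult_prime prime_dvd_mult_iff)
    qed
    then show ?thesis by (simp add: totient_weight_def A_def)
  qed
  moreover have "totient d > 0" "totient (p * d) > 0" using assms prime_gt_0_nat by auto
  ultimately show ?thesis by (simp add: totient_weight_def A_def[symmetric] field_simps)
qed

text \<open>A divisor of \<open>p * n\<close> that does not divide \<open>n\<close> contains one
  more factor \<open>p\<close> than \<open>n\<close> does. Removing that factor leaves a divisor of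
  \<open>n\<close> with the full power of \<open>p\<close>.\<close>

lemma multiples_dividing_mult_prime:
  fixes e n p :: nat
  assumes p: "prime p" and "e dvd n" and "n > 0"
  shows "{d. e dvd d \<and> d dvd p * n} = {d. e dvd d \<and> d dvd n} \<union>
      (*) p ` {d. e dvd d \<and> d dvd n \<and> \<not> p dvd n div d}" (is "?L = ?D \<union> ?R")
proof (intro subset_antisym subsetI)
  fix d assume "d \<in> ?L"
  then have ed: "e dvd d" and "d dvd p * n" by auto
  then obtain c where c: "p * n = d * c" by (auto elim: dvdE)
  show "d \<in> ?D \<union> ?R"
  proof (cases "d dvd n")
    case True
    then show ?thesis using ed by simp
  next
    case False
    have nc: "\<not> p dvd c"
    proof
      assume "p dvd c"
      then obtain c' where "c = p * c'" by (auto elim: dvdE)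
      then have "n = d * c'" using c p prime_gt_0_nat by (auto simp: mult.left_commute)
      then show False using False by simp
    qed
    moreover have "p dvd d * c" using c by (metis dvd_triv_left)
    ultimately have "p dvd d" using p by (simp add: prime_dvd_mult_iff)
    then obtain d' where d: "d = p * d'" by (auto elim: dvdE)
    then have n: "n = d' * c" using c p prime_gt_0_nat by (auto simp: mult.assoc)
    have "coprime p c" using p nc by (rule prime_imp_coprime)
    \<comment> \<open>\<open>e\<close> divides both \<open>d = d' * p\<close> and
      \<open>n = d' * c\<close>, whose gcd is \<open>d'\<close> because \<open>p\<close> and
      \<open>c\<close> are coprime.\<close>
    moreover have "e dvd gcd (d' * p) (d' * c)"
      using ed d \<open>e dvd n\<close> n by (simp add: mult.commute)
    ultimately have "e dvd d'" by (simp add: gcd_mult_distrib_nat[symmetric])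
    moreover have "n div d' = c" using n \<open>n > 0\<close> by auto
    ultimately show ?thesis using d n nc by auto
  qed
next
  fix d assume "d \<in> ?D \<union> ?R"
  then show "d \<in> ?L" by auto
qed

text \<open>Passing from \<open>n\<close> to \<open>p * n\<close> splits exactly the weights of those \<open>d\<close> for which \<open>p\<close> does not
  divide \<open>n div d\<close>: the weight of \<open>d\<close> is shared between \<open>d\<close> and \<open>p * d\<close>.\<close>

lemma sum_totient_weight:
  assumes "e > 0" "r > 0"
  shows "(\<Sum>d | e dvd d \<and> d dvd r * e. totient_weight d (r * e div d)) = 1 / totient e"
  using assms(2)
proof (induction r rule: prime_divisors_induct)
  case zero
  then show ?case by simp
next
  case (unit r)
  then have "r = 1" by simp
  moreover have "{d. e dvd d \<and> d dvd e} = {e}" by (auto intro: dvd_antisym)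
  ultimately show ?case using \<open>e > 0\<close> by (simp add: totient_weight_def)
next
  case (factor p r)
  then have p: "prime p" and r: "r > 0" by auto
  define n where "n = r * e"
  have n: "n > 0" "e dvd n" using r \<open>e > 0\<close> by (auto simp: n_def)
  define D where "D = {d. e dvd d \<and> d dvd n}"
  define X where "X = {d. e dvd d \<and> d dvd n \<and> \<not> p dvd n div d}"
  have D: "finite D" "X \<subseteq> D" using n by (auto simp: D_def X_def intro: finite_subset[of _ "{d. d dvd n}"])
  then have X: "finite X" using finite_subset by blast
  have p0: "p > 0" using p prime_gt_0_nat by auto
  \<comment> \<open>If \<open>p * d\<close> divided \<open>n\<close>, then \<open>p\<close> would
    divide \<open>n div d\<close>, which membership in \<open>X\<close> excludes.\<close>
  have disj: "D \<inter> (*) p ` X = {}"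
  proof -
    have False if d: "d \<in> X" "p * d \<in> D" for d
    proof -
      have "d > 0" using d n by (auto simp: X_def intro: Nat.gr0I)
      moreover have "d * p dvd n" using d by (auto simp: D_def mult.commute)
      ultimately have "p dvd n div d" using d by (auto elim!: dvdE)
      then show False using d by (auto simp: X_def)
    qed
    then show ?thesis by auto
  qed
  \<comment> \<open>If \<open>p\<close> already divides \<open>n div d\<close>, the set of primes in
    the Euler product does not change; otherwise the weight splits.\<close>
  have step1: "totient_weight d (p * n div d) + (if d \<in> X then totient_weight (p * d) (n div d) else 0)
      = totient_weight d (n div d)" if "d \<in> D" for d
  proof -
    have d: "d > 0" "n div d > 0" "p * n div d = p * (n div d)" "d dvd n" "e dvd d"
      using that n by (auto simp: D_def div_mult_swap intro: Nat.gr0I elim!: dvdE)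
    show ?thesis
    proof (cases "p dvd n div d")
      case True
      then show ?thesis using totient_weight_mult_prime_dvd[OF p True d(2)] d by (simp add: X_def)
    next
      case False
      then show ?thesis using totient_weight_mult_prime_not_dvd[OF p False d(2,1)] d by (simp add: X_def)
    qed
  qed
  have "(\<Sum>d | e dvd d \<and> d dvd p * n. totient_weight d (p * n div d))
      = (\<Sum>d\<in>D. totient_weight d (p * n div d)) + (\<Sum>d\<in>(*) p ` X. totient_weight d (p * n div d))"
    unfolding multiples_dividing_mult_prime[OF p n(2,1)] D_def[symmetric] X_def[symmetric]
    using D X disj by (intro sum.union_disjoint) auto
  also have "(\<Sum>d\<in>(*) p ` X. totient_weight d (p * n div d))
      = (\<Sum>d\<in>X. totient_weight (p * d) (n div d))"
    using p0 by (subst sum.reindex) (auto simp: inj_on_def)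
  also have "\<dots> = (\<Sum>d\<in>D. if d \<in> X then totient_weight (p * d) (n div d) else 0)"
    using D by (simp add: sum.If_cases Int_absorb1)
  also have "(\<Sum>d\<in>D. totient_weight d (p * n div d)) + \<dots> = (\<Sum>d\<in>D. totient_weight d (n div d))"
    using step1 by (simp add: sum.distrib[symmetric])
  also have "\<dots> = 1 / totient e"
    using factor.IH[OF r] by (simp add: D_def n_def)
  finally show ?case by (simp add: n_def mult.assoc)
qed

section \<open>Counting cyclic subgroups through roots of unity in the group\<close>

lemma (in group) card_cyclic_subgroups_totient_weight:
  assumes fin: "finite (carrier G)"
  shows "real (card (cyclic_subgroups G)) =
    (\<Sum>d | d dvd order G. totient_weight d (order G div d) * card {x \<in> carrier G. x [^] d = \<one>})"
proof -
  define n where "n = order G"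
  have n: "n > 0" using fin order_gt_0_iff_finite by (simp add: n_def)
  \<comment> \<open>The condition \<open>ord x dvd d\<close> is moved into the summand, so that the
    range of \<open>d\<close> is independent of \<open>x\<close> and the sums can be
    exchanged.\<close>
  have ord: "1 / real (totient (ord x)) =
      (\<Sum>d | d dvd n. if ord x dvd d then totient_weight d (n div d) else 0)"
    if x: "x \<in> carrier G" for x
  proof -
    obtain r where r: "n = r * ord x"
      using ord_dvd_group_order[OF x] by (metis dvdE mult.commute n_def)
    have "(\<Sum>d | d dvd n. if ord x dvd d then totient_weight d (n div d) else 0)
        = (\<Sum>d | ord x dvd d \<and> d dvd n. totient_weight d (n div d))"
      using n by (simp add: sum.If_cases Collect_conj_eq Int_commute)
    also have "\<dots> = 1 / real (totient (ord x))"
      using sum_totient_weight[of "ord x" r] n r by simp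
    finally show ?thesis by simp
  qed
  have "real (card (cyclic_subgroups G)) =
      (\<Sum>x\<in>carrier G. \<Sum>d | d dvd n. if ord x dvd d then totient_weight d (n div d) else 0)"
    using ord by (simp add: card_cyclic_subgroups[OF fin])
  also have "\<dots> = (\<Sum>d | d dvd n. \<Sum>x\<in>carrier G. if ord x dvd d then totient_weight d (n div d) else 0)"
    by (rule sum.swap)
  also have "\<dots> = (\<Sum>d | d dvd n. totient_weight d (n div d) * card {x \<in> carrier G. x [^] d = \<one>})"
  proof (rule sum.cong[OF refl])
    fix d
    have "{x \<in> carrier G. x [^] d = \<one>} = {x \<in> carrier G. ord x dvd d}"
      using pow_eq_id by auto
    then show "(\<Sum>x\<in>carrier G. if ord x dvd d then totient_weight d (n div d) else 0)
        = totient_weight d (n div d) * card {x \<in> carrier G. x [^] d = \<one>}"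
      using fin by (simp add: sum.If_cases Int_def)
  qed
  finally show ?thesis by (simp add: n_def)
qed

section \<open>The unit group modulo \<open>q\<close>\<close>

text \<open>For \<open>d > 0\<close> every solution of \<open>x ^ d = 1\<close> modulo
  \<open>q\<close> is a unit, so \<open>rho\<close> counts elements of the group. For
  \<open>d = 0\<close> it would count all \<open>q\<close> residues instead.\<close>

lemma
  assumes q: "q > 1"
  shows group_mult_residue_group: "group (mult_residue_group q)"
    and finite_mult_residue_group: "finite (carrier (mult_residue_group q))"
    and order_mult_residue_group: "order (mult_residue_group q) = totient q"
    and card_roots_mult_residue_group: "d > 0 \<Longrightarrow>
      card {x \<in> carrier (mult_residue_group q).
        x [^]\<^bsub>mult_residue_group q\<^esub> d = \<one>\<^bsub>mult_residue_group q\<^esub>} = rho q d"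
proof -
  interpret R: residues "int q" "residue_ring (int q)"
    using q by unfold_locales auto
  have carrier: "carrier (mult_residue_group q) = Units (residue_ring (int q))"
    by (simp add: mult_residue_group_def units_of_carrier)
  show "group (mult_residue_group q)"
    by (simp add: mult_residue_group_def R.units_group)
  show "finite (carrier (mult_residue_group q))" by (simp add: carrier)
  show "order (mult_residue_group q) = totient q"
    using R.totient_eq by (simp add: order_def carrier)
  assume d: "d > 0"
  have pow: "x [^]\<^bsub>mult_residue_group q\<^esub> d = x ^ d mod int q"
    if "x \<in> Units (residue_ring (int q))" for x
    using that R.pow_cong[of x d]
    by (simp add: mult_residue_group_def R.units_of_pow R.res_units_eq)
  have one: "\<one>\<^bsub>mult_residue_group q\<^esub> = 1"
    by (simp add: mult_residue_group_def units_of_one R.res_one_eq)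
  have cong: "[int x ^ d = 1] (mod int q) \<longleftrightarrow> [x ^ d = 1] (mod q)" for x
    using cong_int_iff[of "x ^ d" 1 q] by simp
  have "{x \<in> carrier (mult_residue_group q).
      x [^]\<^bsub>mult_residue_group q\<^esub> d = \<one>\<^bsub>mult_residue_group q\<^esub>}
      = int ` {x \<in> {0..<q}. [x ^ d = 1] (mod q)}" (is "?L = ?R")
  proof (intro subset_antisym subsetI)
    fix x assume "x \<in> ?L"
    then have x: "0 < x" "x < int q" "x ^ d mod int q = 1"
      using pow one by (auto simp: carrier R.res_units_eq)
    then have "[int (nat x) ^ d = 1] (mod int q)" using q by (simp add: cong_def)
    then have "[nat x ^ d = 1] (mod q)" by (simp only: cong)
    then show "x \<in> ?R" using x by (intro image_eqI[of _ _ "nat x"]) auto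
  next
    fix x assume "x \<in> ?R"
    then obtain y where y: "x = int y" "y < q" "[y ^ d = 1] (mod q)" by auto
    then have c: "[x ^ d = 1] (mod int q)" using cong by simp
    \<comment> \<open>A power congruent to 1 is coprime to \<open>q\<close>, and as
      \<open>d > 0\<close> so is its base.\<close>
    have "coprime (y ^ d) q"
      using cong_imp_coprime[OF cong_sym[OF y(3)]] by simp
    then have cop: "coprime y q" using d by simp
    then have "y \<noteq> 0" using q by (cases "y = 0") auto
    then have "x \<in> Units (residue_ring (int q))" using y cop by (simp add: R.res_units_eq)
    then show "x \<in> ?L" using pow one c q by (simp add: carrier cong_def)
  qed
  then show "card {x \<in> carrier (mult_residue_group q).
        x [^]\<^bsub>mult_residue_group q\<^esub> d = \<one>\<^bsub>mult_residue_group q\<^esub>} = rho q d"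
    by (simp add: rho_def card_image)
qed

section \<open>Matching the weights with the products of the formula\<close>

lemma totient_weight_odd:
  assumes "odd d" "even r" "r > 0"
  shows "totient_weight d r = 0"
proof -
  have "2 \<in> prime_factors r" using assms by (simp add: in_prime_factors_iff)
  moreover have "1 - real (totient d) / real (totient (2 * d)) = 0"
    using assms totient_mult_prime[of 2 d] by (auto intro: Nat.gr0I)
  ultimately have "(\<Prod>p\<in>prime_factors r. 1 - real (totient d) / real (totient (p * d))) = 0"
    by (intro prod_zero) (rule finite_set_mset, rule bexI)
  then show ?thesis by (simp add: totient_weight_def)
qed

text \<open>The comparison is made prime by prime. The outer product supplies
  \<open>(p - 2) / (p - 1)\<close> at every odd prime of \<open>n\<close>. The first inner product
  corrects this to \<open>(p - 1) / p\<close> where \<open>p\<close> divides both \<open>d\<close>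
  and \<open>n div d\<close>, and the second cancels it where \<open>p\<close> does not divide
  \<open>n div d\<close>.\<close>

lemma totient_weight_even:
  fixes n d :: nat
  assumes n: "n > 0" and d: "d dvd n" "even d"
  shows "(\<Prod>p\<in>{p::nat. prime p \<and> p dvd n \<and> p \<noteq> 2}. (real p - 2) / (real p - 1)) *
       (1 / real (totient d)
       * (\<Prod>p\<in>{p::nat. prime p \<and> p dvd d \<and> p dvd n div d \<and> p \<noteq> 2}.
            (real p - 1)\<^sup>2 / (real p * (real p - 2)))
       * (\<Prod>p\<in>{p::nat. prime p \<and> p dvd d \<and> \<not> p dvd n div d \<and> p \<noteq> 2}.
            (real p - 1) / (real p - 2))
       * (if 2 dvd d \<and> 2 dvd n div d then 1 / 2 else 1)) = totient_weight d (n div d)"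
proof -
  define r where "r = n div d"
  have nr: "n = d * r" using d by (simp add: r_def)
  have d0: "d > 0" "r > 0" using n nr by auto
  define P where "P = {p::nat. prime p \<and> p dvd n \<and> p \<noteq> 2}"
  have finP: "finite P" using n by (auto simp: P_def intro: finite_subset[of _ "{d. d dvd n}"])
  define f where "f = (\<lambda>p. 1 - real (totient d) / real (totient (p * d)))"
  have f: "f p = (if p dvd d then (real p - 1) / real p else (real p - 2) / (real p - 1))"
    if "prime p" for p
    using d0 prime_gt_1_nat[OF that] unfolding f_def totient_mult_prime[OF that]
    by (auto simp: field_simps of_nat_diff)
  \<comment> \<open>All three products are brought to the common index set \<open>P\<close>, with
    default factor 1, so that they can be compared factorwise.\<close>
  have "(\<Prod>p\<in>P. (real p - 2) / (real p - 1))
      * ((\<Prod>p\<in>{p\<in>P. p dvd d \<and> p dvd r}. (real p - 1)\<^sup>2 / (real p * (real p - 2)))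
       * (\<Prod>p\<in>{p\<in>P. p dvd d \<and> \<not> p dvd r}. (real p - 1) / (real p - 2)))
      = (\<Prod>p\<in>P. (real p - 2) / (real p - 1)
        * ((if p dvd d \<and> p dvd r then (real p - 1)\<^sup>2 / (real p * (real p - 2)) else 1)
         * (if p dvd d \<and> \<not> p dvd r then (real p - 1) / (real p - 2) else 1)))"
    using finP by (simp only: prod.distrib prod.inter_filter)
  also have "\<dots> = (\<Prod>p\<in>P. if p dvd r then f p else 1)"
  proof (rule prod.cong[OF refl])
    fix p assume "p \<in> P"
    then have p: "prime p" "p dvd d \<or> p dvd r" "p \<noteq> 2"
      using prime_dvd_mult_iff nr by (auto simp: P_def)
    \<comment> \<open>Excluding 2 makes \<open>p - 2\<close> nonzero, so the correcting quotients
      really cancel.\<close>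
    then have "p > 2" using prime_ge_2_nat[OF p(1)] by simp
    then have "real p > 2" by simp
    then show "(real p - 2) / (real p - 1)
        * ((if p dvd d \<and> p dvd r then (real p - 1)\<^sup>2 / (real p * (real p - 2)) else 1)
         * (if p dvd d \<and> \<not> p dvd r then (real p - 1) / (real p - 2) else 1))
        = (if p dvd r then f p else 1)"
      using p by (auto simp: f power2_eq_square)
  qed
  also have "\<dots> = (\<Prod>p\<in>{p\<in>P. p dvd r}. f p)"
    using finP by (simp only: prod.inter_filter)
  also have "{p\<in>P. p dvd r} = prime_factors r - {2}"
    using d0 nr by (auto simp: P_def in_prime_factors_iff)
  finally have main: "(\<Prod>p\<in>P. (real p - 2) / (real p - 1))
      * ((\<Prod>p\<in>{p\<in>P. p dvd d \<and> p dvd r}. (real p - 1)\<^sup>2 / (real p * (real p - 2)))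
       * (\<Prod>p\<in>{p\<in>P. p dvd d \<and> \<not> p dvd r}. (real p - 1) / (real p - 2)))
      = (\<Prod>p\<in>prime_factors r - {2}. f p)" .
  \<comment> \<open>As \<open>d\<close> is even, the Euler factor at 2 is
    \<open>(2 - 1) / 2\<close>; it occurs only if 2 divides \<open>r\<close>.\<close>
  have two: "(\<Prod>p\<in>prime_factors r. f p)
      = (\<Prod>p\<in>prime_factors r - {2}. f p) * (if 2 dvd d \<and> 2 dvd r then 1 / 2 else 1)"
  proof (cases "2 dvd r")
    case True
    then have "2 \<in> prime_factors r" using d0 by (simp add: in_prime_factors_iff)
    then show ?thesis using True d f[of 2] by (simp add: prod.remove[of _ 2])
  next
    case False
    then have "2 \<notin> prime_factors r" by (simp add: in_prime_factors_iff)
    then show ?thesis using False by simp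
  qed
  have sets: "{p. prime p \<and> p dvd d \<and> p dvd r \<and> p \<noteq> 2} = {p\<in>P. p dvd d \<and> p dvd r}"
    "{p. prime p \<and> p dvd d \<and> \<not> p dvd r \<and> p \<noteq> 2} = {p\<in>P. p dvd d \<and> \<not> p dvd r}"
    using nr by (auto simp: P_def)
  have rearrange: "a * (1 / t * b * c * u) = a * (b * c) * u / t" for a b c u t :: real
    by simp
  show ?thesis
    unfolding r_def[symmetric] P_def[symmetric] sets rearrange main totient_weight_def
    using two by (simp add: f_def)
qed

theorem proposition7p3:
  fixes q :: nat
  assumes "q \<ge> 3"
  shows "real (card (cyclic_subgroups (mult_residue_group q))) =
    (\<Prod>p\<in>{p::nat. prime p \<and> p dvd totient q \<and> p \<noteq> 2}. (real p - 2) / (real p - 1)) *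
    (\<Sum>d\<in>{d::nat. d dvd totient q \<and> 2 dvd d}.
       real (rho q d) / real (totient d)
       * (\<Prod>p\<in>{p::nat. prime p \<and> p dvd d \<and> p dvd totient q div d \<and> p \<noteq> 2}.
            (real p - 1)\<^sup>2 / (real p * (real p - 2)))
       * (\<Prod>p\<in>{p::nat. prime p \<and> p dvd d \<and> \<not> p dvd totient q div d \<and> p \<noteq> 2}.
            (real p - 1) / (real p - 2))
       * (if 2 dvd d \<and> 2 dvd totient q div d then 1 / 2 else 1))"
    (is "_ = ?A * (\<Sum>d\<in>_. _ / _ * ?B d * ?C d * ?E d)")
proof -
  have q: "q > 1" using assms by simp
  interpret G: group "mult_residue_group q" using q by (rule group_mult_residue_group)
  define n where "n = totient q"
  \<comment> \<open>The bound \<open>q \<ge> 3\<close> makes \<open>totient q\<close> even, which is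
    what removes the odd divisors below.\<close>
  have n: "n > 0" "even n" using assms totient_even[of q] by (auto simp: n_def)
  have pos: "d > 0" if "d dvd n" for d using that n by (auto intro: Nat.gr0I)
  have "real (card (cyclic_subgroups (mult_residue_group q)))
      = (\<Sum>d | d dvd n. totient_weight d (n div d) * rho q d)"
    using G.card_cyclic_subgroups_totient_weight[OF finite_mult_residue_group[OF q]] pos
    by (simp add: order_mult_residue_group[OF q] card_roots_mult_residue_group[OF q] n_def)
  also have "\<dots> = (\<Sum>d | d dvd n \<and> 2 dvd d. totient_weight d (n div d) * rho q d)"
  proof (rule sum.mono_neutral_right)
    show "\<forall>d\<in>{d. d dvd n} - {d. d dvd n \<and> 2 dvd d}. totient_weight d (n div d) * rho q d = 0"
    proof safe
      fix d assume d: "d dvd n" "totient_weight d (n div d) * rho q d \<noteq> 0"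
      obtain r where r: "n = d * r" using d by (auto elim: dvdE)
      show "2 dvd d"
      proof (rule ccontr)
        assume "odd d"
        \<comment> \<open>Since \<open>n = d * r\<close> is even and \<open>d\<close> is odd,
          \<open>r\<close> is even.\<close>
        then have "totient_weight d r = 0" using n r by (intro totient_weight_odd) auto
        then show False using d r n by auto
      qed
    qed
  qed (use n in auto)
  also have "\<dots> = (\<Sum>d | d dvd n \<and> 2 dvd d.
      ?A * (real (rho q d) / real (totient d) * ?B d * ?C d * ?E d))"
  proof (rule sum.cong[OF refl], safe)
    fix d assume d: "d dvd n" "even d"
    have rearrange: "a * (1 / t * b * c * u) * w = a * (w / t * b * c * u)" for a b c u t w :: real
      by simp
    show "totient_weight d (n div d) * rho q d
        = ?A * (real (rho q d) / real (totient d) * ?B d * ?C d * ?E d)"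
      unfolding totient_weight_even[OF n(1) d, symmetric] rearrange by (simp only: n_def)
  qed
  finally show ?thesis by (simp only: sum_distrib_left n_def)
qed

end
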